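(* Let $\mathcal P$ be an integral $d$-simplex with $\delta$-vector $(\delta_0,\ldots,\delta_d)$. If the normalized volume of $\mathcal P$ equals $p$ for a prime number $p$ and $$\min\{i>0:\delta_i\neq0\}=d+1-\max\{i:\delta_i\neq0\},$$ then $\delta(\mathcal P)$ is shifted symmetric.
   Context: For an integral convex polytope $\mathcal P\subset\mathbb R^N$ of dimension $d$, let $i(\mathcal P,n)=|n\mathcal P\cap\mathbb Z^N|$. The $\delta$-vector $\delta(\mathcal P)=(\delta_0,\ldots,\delta_d)$ is defined by $(1-\lambda)^{d+1}\bigl[1+\sum_{n\ge1}i(\mathcal P,n)\lambda^n\bigr]=\sum_{i=0}^d\delta_i\lambda^i$. The normalized volume of $\mathcal P$ is $\sum_{i=0}^d\delta_i$. $\delta(\mathcal P)$ is called shifted symmetric if $\delta_{d-i}=\delta_{i+1}$ for every $0\le i\le\lfloor (d-1)/2\rfloor$. *)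

theory Defs
  imports "HOL-Analysis.Analysis" "HOL-Computational_Algebra.Formal_Power_Series"
begin

definition integer_lattice :: "(real ^ 'n) set"
  where "integer_lattice = {x. \<forall>i. x $ i \<in> \<int>}"

definition integral_polytope :: "(real ^ 'n) set \<Rightarrow> bool"
  where "integral_polytope P \<longleftrightarrow>
    polytope P \<and> (\<forall>v. v extreme_point_of P \<longrightarrow> v \<in> integer_lattice)"

definition lattice_count :: "(real ^ 'n) set \<Rightarrow> nat \<Rightarrow> nat"
  where "lattice_count P n = card ((\<lambda>x. real n *\<^sub>R x) ` P \<inter> integer_lattice)"

definition ehrhart_series :: "(real ^ 'n) set \<Rightarrow> int fps"
  where "ehrhart_series P = 1 + Abs_fps (\<lambda>n. if n \<ge> 1 then int (lattice_count P n) else 0)"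

definition poly_dim :: "(real ^ 'n) set \<Rightarrow> nat"
  where "poly_dim P = nat (aff_dim P)"

text \<open>The entries of the delta-vector of \<open>P\<close> are the values at the indices \<open>0, \<dots>, poly_dim P\<close>.
  For an integral polytope the coefficients with larger index vanish by Ehrhart's theorem; the
  definitions below only ever refer to the indices up to the dimension.\<close>

definition delta :: "(real ^ 'n) set \<Rightarrow> nat \<Rightarrow> int"
  where "delta P i = fps_nth ((1 - fps_X) ^ (poly_dim P + 1) * ehrhart_series P) i"

definition normalized_volume :: "(real ^ 'n) set \<Rightarrow> int"
  where "normalized_volume P = (\<Sum>i=0..poly_dim P. delta P i)"

text \<open>The bound is computed in the integers, so that it is \<open>-1\<close> (no condition) for \<open>d = 0\<close>.\<close>

definition shifted_symmetric :: "nat \<Rightarrow> (nat \<Rightarrow> int) \<Rightarrow> bool"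
  where "shifted_symmetric d \<delta> \<longleftrightarrow>
    (\<forall>i. int i \<le> (int d - 1) div 2 \<longrightarrow> \<delta> (d - i) = \<delta> (i + 1))"

end

theory Submission
  imports Defs "HOL-Algebra.Coset"
begin

text \<open>Let \<open>V\<close> be the vertex set. Unique barycentric coordinates identify the lattice points of
  \<open>n P\<close> with nonnegative weights on \<open>V\<close> of total \<open>n\<close>; each factor \<open>1 - \<lambda>\<close> of the
  \<open>\<delta>\<close>-series cuts one weight down to \<open>[0,1)\<close>, so \<open>\<delta>\<^sub>i\<close> counts the box points of degree \<open>i\<close>. Addition
  modulo \<open>1\<close> makes the box a group of order \<open>p\<close>, so by Lagrange each coordinate vanishes either on
  the whole box or only at the neutral element. With \<open>k\<close> coordinates of the second kind, inversion
  sends degree \<open>i\<close> to \<open>k - i\<close> on the nonzero box points. The hypothesis on the extreme degrees forces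
  \<open>k = d + 1\<close>, which is the asserted symmetry.\<close>

section \<open>Closure and finiteness properties of the integer lattice\<close>

lemma integer_lattice_add: "x \<in> integer_lattice \<Longrightarrow> y \<in> integer_lattice \<Longrightarrow> x + y \<in> integer_lattice"
  by (simp add: integer_lattice_def)

lemma integer_lattice_diff: "x \<in> integer_lattice \<Longrightarrow> y \<in> integer_lattice \<Longrightarrow> x - y \<in> integer_lattice"
  by (simp add: integer_lattice_def)

lemma integer_lattice_zero: "0 \<in> integer_lattice"
  by (simp add: integer_lattice_def)

lemma integer_lattice_sum_scale:
  assumes "\<And>v. v \<in> V \<Longrightarrow> c v \<in> \<int>" "V \<subseteq> integer_lattice"
  shows "(\<Sum>v\<in>V. c v *\<^sub>R v) \<in> integer_lattice"
  using assms by (auto simp: integer_lattice_def sum_component intro!: Ints_sum Ints_mult)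

text \<open>A bound on the norm bounds each coordinate, which leaves finitely many integer values
  per coordinate.\<close>

lemma finite_bounded_integer_lattice:
  fixes S :: "(real ^ 'n) set"
  assumes "bounded S"
  shows "finite (S \<inter> integer_lattice)"
proof -
  obtain B where B: "\<And>x. x \<in> S \<Longrightarrow> norm x \<le> B"
    using assms by (auto simp: bounded_iff)
  let ?A = "{k :: real. k \<in> \<int> \<and> \<bar>k\<bar> \<le> B}"
  have "?A \<subseteq> of_int ` {- \<lceil>B\<rceil>..\<lceil>B\<rceil>}"
  proof
    fix k assume "k \<in> ?A"
    then obtain m where "k = of_int m" "\<bar>of_int m :: real\<bar> \<le> B"
      by (auto elim!: Ints_cases)
    then show "k \<in> of_int ` {- \<lceil>B\<rceil>..\<lceil>B\<rceil>}"
      by (auto intro!: imageI) linarith+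
  qed
  then have "finite ?A"
    by (rule finite_subset) simp
  then have fin: "finite (PiE (UNIV :: 'n set) (\<lambda>_. ?A))"
    by (intro finite_PiE) auto
  have "S \<inter> integer_lattice \<subseteq> vec_lambda ` (PiE (UNIV :: 'n set) (\<lambda>_. ?A))"
  proof
    fix x assume x: "x \<in> S \<inter> integer_lattice"
    have "x $ i \<in> ?A" for i
      using x B[of x] component_le_norm_cart[of x i] by (auto simp: integer_lattice_def)
    then have "vec_nth x \<in> PiE UNIV (\<lambda>_. ?A)"
      by auto
    then show "x \<in> vec_lambda ` (PiE UNIV (\<lambda>_. ?A))"
      by (intro image_eqI[of _ _ "vec_nth x"]) simp_all
  qed
  then show ?thesis
    using fin finite_subset by blast
qed

section \<open>Weights on the vertices of a lattice simplex\<close>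

locale lattice_simplex =
  fixes V :: "(real ^ 'n) set"
  assumes indep: "\<not> affine_dependent V"
    and lattice: "V \<subseteq> integer_lattice"
    and nonempty: "V \<noteq> {}"
begin

lemma finite_V: "finite V"
  using indep by (rule aff_independent_finite)

text \<open>Coefficient functions of the points of the integer lattice one dimension up that lie in
  the span of the lifted vertices \<open>(v, 1)\<close>. No sign is imposed, so differences stay
  inside; the value 0 off \<open>V\<close> makes each function unique, so that functions can be
  counted.\<close>

definition weights :: "(real ^ 'n \<Rightarrow> real) set"
  where "weights = {r. (\<forall>v. v \<notin> V \<longrightarrow> r v = 0) \<and> sum r V \<in> \<int> \<and>
    (\<Sum>v\<in>V. r v *\<^sub>R v) \<in> integer_lattice}"

lemma weights_add: "r \<in> weights \<Longrightarrow> s \<in> weights \<Longrightarrow> (\<lambda>v. r v + s v) \<in> weights"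
  by (auto simp: weights_def sum.distrib scaleR_add_left integer_lattice_add)

lemma weights_diff: "r \<in> weights \<Longrightarrow> s \<in> weights \<Longrightarrow> (\<lambda>v. r v - s v) \<in> weights"
  by (auto simp: weights_def sum_subtractf scaleR_diff_left integer_lattice_diff)

lemma weights_integral:
  "(\<And>v. v \<notin> V \<Longrightarrow> c v = 0) \<Longrightarrow> (\<And>v. c v \<in> \<int>) \<Longrightarrow> c \<in> weights"
  using lattice by (auto simp: weights_def intro!: integer_lattice_sum_scale Ints_sum)

text \<open>Subtracting the floors removes an integral weight, which is a weight because the
  vertices are lattice points.\<close>

lemma weights_frac:
  assumes "r \<in> weights"
  shows "(\<lambda>v. frac (r v)) \<in> weights"
proof -
  have "(\<lambda>v. of_int \<lfloor>r v\<rfloor>) \<in> weights"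
    using assms by (intro weights_integral) (auto simp: weights_def)
  from weights_diff[OF assms this] show ?thesis
    by (simp add: frac_def)
qed

text \<open>A nonzero difference of the two would be an affine dependence of the vertices.\<close>

lemma weights_inj:
  assumes "r \<in> weights" "s \<in> weights" "sum r V = sum s V"
    "(\<Sum>v\<in>V. r v *\<^sub>R v) = (\<Sum>v\<in>V. s v *\<^sub>R v)"
  shows "r = s"
proof (rule ccontr)
  assume "r \<noteq> s"
  then obtain v where v: "r v \<noteq> s v" by auto
  then have "v \<in> V" using assms(1,2) by (force simp: weights_def)
  with v have "affine_dependent V"
    unfolding affine_dependent_explicit_finite[OF finite_V] using assms
    by (intro exI[of _ "\<lambda>v. r v - s v"]) (auto simp: sum_subtractf scaleR_diff_left)
  with indep show False by simp
qed

text \<open>Interpolates between the lattice points of the dilated simplex (\<open>W = {}\<close>)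
  and the box points of degree \<open>n\<close> (\<open>W = V\<close>).\<close>

definition cut_weights :: "(real ^ 'n) set \<Rightarrow> nat \<Rightarrow> (real ^ 'n \<Rightarrow> real) set"
  where "cut_weights W n = {r \<in> weights. (\<forall>v. 0 \<le> r v) \<and> (\<forall>v\<in>W. r v < 1) \<and> sum r V = real n}"

lemma bij_betw_cut_weights_empty:
  assumes "n \<ge> 1"
  shows "bij_betw (\<lambda>r. \<Sum>v\<in>V. r v *\<^sub>R v) (cut_weights {} n)
    ((\<lambda>x. real n *\<^sub>R x) ` (convex hull V) \<inter> integer_lattice)"
proof (rule bij_betw_imageI)
  show "inj_on (\<lambda>r. \<Sum>v\<in>V. r v *\<^sub>R v) (cut_weights {} n)"
    by (intro inj_onI weights_inj) (auto simp: cut_weights_def)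
  show "(\<lambda>r. \<Sum>v\<in>V. r v *\<^sub>R v) ` cut_weights {} n =
    (\<lambda>x. real n *\<^sub>R x) ` (convex hull V) \<inter> integer_lattice" (is "?L = ?R")
  proof (intro equalityI subsetI)
    fix x assume "x \<in> ?L"
    then obtain r where r: "r \<in> cut_weights {} n" "x = (\<Sum>v\<in>V. r v *\<^sub>R v)" by auto
    \<comment> \<open>Dividing by \<open>n\<close> turns weights of total \<open>n\<close> into
      barycentric coordinates; this uses \<open>n \<ge> 1\<close>.\<close>
    let ?u = "\<lambda>v. r v / real n"
    have "(\<Sum>v\<in>V. ?u v *\<^sub>R v) \<in> convex hull V"
      using r assms unfolding convex_hull_finite[OF finite_V]
      by (auto simp: cut_weights_def simp flip: sum_divide_distrib intro!: exI[of _ ?u])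
    moreover have "x = real n *\<^sub>R (\<Sum>v\<in>V. ?u v *\<^sub>R v)"
      using r assms by (simp add: scaleR_sum_right)
    ultimately show "x \<in> ?R"
      using r by (auto simp: cut_weights_def weights_def)
  next
    fix x assume x: "x \<in> ?R"
    then obtain u where u: "\<And>v. v \<in> V \<Longrightarrow> 0 \<le> u v" "sum u V = 1"
      "x = real n *\<^sub>R (\<Sum>v\<in>V. u v *\<^sub>R v)"
      unfolding convex_hull_finite[OF finite_V] by auto
    \<comment> \<open>The convex hull leaves \<open>u\<close> arbitrary off \<open>V\<close>, so it
      is reset to 0 there.\<close>
    let ?r = "\<lambda>v. if v \<in> V then real n * u v else 0"
    have s: "sum ?r V = real n"
      using u by (simp flip: sum_distrib_left)
    have e: "(\<Sum>v\<in>V. ?r v *\<^sub>R v) = x"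
      using u by (simp add: scaleR_sum_right)
    have "?r \<in> cut_weights {} n"
      using x u s e by (auto simp: cut_weights_def weights_def)
    then show "x \<in> ?L" by (intro image_eqI[where x = ?r]) (simp_all only: e)
  qed
qed

text \<open>Accounts for the constant term 1 that \<open>ehrhart_series\<close> prescribes.\<close>

lemma cut_weights_0: "cut_weights {} 0 = {\<lambda>_. 0}"
proof (intro equalityI subsetI)
  fix r assume r: "r \<in> cut_weights {} 0"
  then have "\<forall>v\<in>V. r v = 0"
    using sum_nonneg_eq_0_iff[OF finite_V, of r] by (auto simp: cut_weights_def)
  with r show "r \<in> {\<lambda>_. 0}"
    by (auto simp: cut_weights_def weights_def)
qed (auto simp: cut_weights_def weights_def integer_lattice_zero)

lemma finite_cut_weights: "finite (cut_weights W n)"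
proof -
  have "finite (cut_weights {} n)"
  proof (cases "n = 0")
    case False
    have "bounded ((\<lambda>x. real n *\<^sub>R x) ` (convex hull V))"
      by (intro bounded_scaling bounded_convex_hull finite_imp_bounded finite_V)
    with False show ?thesis
      using bij_betw_finite[OF bij_betw_cut_weights_empty[of n]]
      by (simp add: finite_bounded_integer_lattice)
  qed (simp add: cut_weights_0)
  then show ?thesis
    by (rule finite_subset[rotated]) (auto simp: cut_weights_def)
qed

section \<open>From the Ehrhart series to the delta-vector\<close>

definition cut_series :: "(real ^ 'n) set \<Rightarrow> int fps"
  where "cut_series W = Abs_fps (\<lambda>n. int (card (cut_weights W n)))"

lemma ehrhart_series_eq: "ehrhart_series (convex hull V) = cut_series {}"
proof (rule fps_ext)
  fix n
  show "fps_nth (ehrhart_series (convex hull V)) n = fps_nth (cut_series {}) n"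
    using bij_betw_same_card[OF bij_betw_cut_weights_empty[of n]]
    by (cases "n = 0")
      (auto simp: ehrhart_series_def cut_series_def lattice_count_def cut_weights_0)
qed

lemma bij_betw_shift_weight:
  assumes "v \<in> V" "v \<notin> W"
  shows "bij_betw (\<lambda>r. r(v := r v + 1)) (cut_weights W n) {r \<in> cut_weights W (Suc n). 1 \<le> r v}"
proof (rule bij_betw_byWitness[where f' = "\<lambda>r. r(v := r v - 1)"])
  \<comment> \<open>The unit weight at \<open>v\<close>: adding it keeps lattice points, raises the
    total by 1 and, as \<open>v \<notin> W\<close>, respects the bounds on \<open>W\<close>.\<close>
  define e where "e = (\<lambda>u. if u = v then 1 else 0 :: real)"
  have e: "e \<in> weights"
    using assms by (intro weights_integral) (auto simp: e_def)
  have sum_e: "sum e V = 1"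
    using assms finite_V by (simp add: e_def)
  have up: "r(v := r v + 1) = (\<lambda>u. r u + e u)" and down: "r(v := r v - 1) = (\<lambda>u. r u - e u)" for r
    by (auto simp: e_def)
  show "(\<lambda>r. r(v := r v + 1)) ` cut_weights W n \<subseteq> {r \<in> cut_weights W (Suc n). 1 \<le> r v}"
    unfolding up using assms e sum_e
    by (auto simp: cut_weights_def sum.distrib weights_add) (auto simp: e_def)
  show "(\<lambda>r. r(v := r v - 1)) ` {r \<in> cut_weights W (Suc n). 1 \<le> r v} \<subseteq> cut_weights W n"
    unfolding down using assms e sum_e
    by (auto simp: cut_weights_def sum_subtractf weights_diff) (auto simp: e_def)
qed auto

text \<open>Coefficient \<open>n\<close> of the product is the count in degree \<open>n\<close>
  minus that in degree \<open>n - 1\<close>. By the shift, the latter counts the functions of degree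
  \<open>n\<close> with \<open>1 \<le> r v\<close>; those left over have
  \<open>r v < 1\<close>.\<close>

lemma cut_series_insert:
  assumes "v \<in> V" "v \<notin> W"
  shows "(1 - fps_X) * cut_series W = cut_series (insert v W)"
proof (rule fps_ext)
  fix n
  let ?B = "{r \<in> cut_weights W n. 1 \<le> r v}"
  have split: "cut_weights W n = cut_weights (insert v W) n \<union> ?B"
    by (auto simp: cut_weights_def)
  have "card (cut_weights W n) = card (cut_weights (insert v W) n \<union> ?B)"
    using split by simp
  also have "\<dots> = card (cut_weights (insert v W) n) + card ?B"
    by (intro card_Un_disjoint finite_subset[OF _ finite_cut_weights[of W n]])
      (auto simp: cut_weights_def)
  finally have card: "card (cut_weights W n) = card (cut_weights (insert v W) n) + card ?B" .
  show "fps_nth ((1 - fps_X) * cut_series W) n = fps_nth (cut_series (insert v W)) n"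
  proof (cases n)
    case 0
    \<comment> \<open>No weight exceeds the total 0, so none reaches 1 and nothing is removed in
      degree 0.\<close>
    have "r v \<le> sum r V" if "r \<in> cut_weights W 0" for r
      using that assms finite_V by (intro member_le_sum) (auto simp: cut_weights_def)
    then have "?B = {}"
      using 0 by (force simp: cut_weights_def)
    then have "card ?B = 0"
      by (simp only: card.empty)
    then show ?thesis
      using card 0 by (simp add: cut_series_def left_diff_distrib)
  next
    case (Suc m)
    then have "card ?B = card (cut_weights W m)"
      using bij_betw_same_card[OF bij_betw_shift_weight[OF assms, of m]] by simp
    then show ?thesis
      using card Suc by (simp add: cut_series_def left_diff_distrib)
  qed
qed

lemma cut_series_subset:
  assumes "W \<subseteq> V"
  shows "(1 - fps_X) ^ card W * cut_series {} = cut_series W"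
  using finite_subset[OF assms finite_V] assms
proof (induction W rule: finite_induct)
  case (insert v W)
  then show ?case
    using cut_series_insert[of v W] by (simp add: mult.assoc)
qed simp

lemma poly_dim_eq: "poly_dim (convex hull V) + 1 = card V"
proof -
  have "card V \<noteq> 0" using finite_V nonempty by simp
  then show ?thesis
    using aff_dim_convex_hull[of V] aff_dim_affine_independent[OF indep]
    by (simp add: poly_dim_def)
qed

text \<open>The exponent, dimension plus one, is the number of vertices: one factor
  \<open>1 - fps_X\<close> for each.\<close>

lemma delta_eq: "delta (convex hull V) i = int (card (cut_weights V i))"
  unfolding delta_def poly_dim_eq ehrhart_series_eq
  by (simp only: cut_series_subset[OF order_refl]) (simp add: cut_series_def)

section \<open>Lattice points of the half-open fundamental parallelepiped\<close>

definition box :: "(real ^ 'n \<Rightarrow> real) set"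
  where "box = {r \<in> weights. \<forall>v. 0 \<le> r v \<and> r v < 1}"

lemma box_frac: "r \<in> weights \<Longrightarrow> (\<lambda>v. frac (r v)) \<in> box"
  using weights_frac by (auto simp: box_def frac_lt_1)

lemma cut_weights_V: "cut_weights V i = {r \<in> box. sum r V = real i}"
proof -
  have "r v < 1" if "r \<in> weights" "\<forall>v\<in>V. r v < 1" for r v
    using that by (cases "v \<in> V") (auto simp: weights_def)
  then show ?thesis
    by (auto simp: cut_weights_def box_def)
qed

text \<open>The total is an integer, and each of the \<open>card V\<close> weights lies in
  [0,1).\<close>

lemma box_degree:
  assumes "r \<in> box"
  obtains i where "i < card V" "sum r V = real i"
proof -
  have "sum r V < sum (\<lambda>_. 1) V"
    using assms finite_V nonempty by (intro sum_strict_mono) (auto simp: box_def)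
  moreover have "sum r V \<ge> 0"
    using assms by (intro sum_nonneg) (auto simp: box_def)
  moreover have "sum r V \<in> \<int>"
    using assms by (auto simp: box_def weights_def)
  ultimately have "nat \<lfloor>sum r V\<rfloor> < card V" "sum r V = real (nat \<lfloor>sum r V\<rfloor>)"
    by (auto elim!: Ints_cases)
  then show thesis by (rule that)
qed

lemma box_eq_Union: "box = (\<Union>i<card V. cut_weights V i)"
  unfolding cut_weights_V using box_degree by blast

lemma finite_box: "finite box"
  unfolding box_eq_Union by (auto intro: finite_cut_weights)

lemma zero_in_box: "(\<lambda>_. 0) \<in> box"
  using weights_integral[of "\<lambda>_. 0"] by (simp add: box_def)

lemma normalized_volume_eq: "normalized_volume (convex hull V) = int (card box)"
proof -
  have "card box = (\<Sum>i<card V. card (cut_weights V i))"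
    unfolding box_eq_Union
    by (intro card_UN_disjoint) (auto simp: finite_cut_weights, auto simp: cut_weights_def)
  moreover have "{0..poly_dim (convex hull V)} = {..<card V}"
    using poly_dim_eq by auto
  ultimately show ?thesis
    by (simp add: normalized_volume_def delta_eq)
qed

section \<open>The box as a group: weights modulo integral weights\<close>

definition box_group :: "(real ^ 'n \<Rightarrow> real) monoid"
  where "box_group = \<lparr>carrier = box, mult = \<lambda>r s v. frac (r v + s v), one = \<lambda>_. 0\<rparr>"

lemma box_neg: "r \<in> box \<Longrightarrow> (\<lambda>v. frac (- r v)) \<in> box"
  using box_frac[OF weights_diff, of "\<lambda>_. 0" r] zero_in_box by (auto simp: box_def)

lemma group_box_group: "group box_group"
proof (rule groupI)
  fix r s assume "r \<in> carrier box_group" "s \<in> carrier box_group"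
  then show "r \<otimes>\<^bsub>box_group\<^esub> s \<in> carrier box_group"
    using box_frac[OF weights_add, of r s] by (simp add: box_group_def box_def)
next
  fix r assume r: "r \<in> carrier box_group"
  then show "\<one>\<^bsub>box_group\<^esub> \<otimes>\<^bsub>box_group\<^esub> r = r"
    by (auto simp: box_group_def box_def frac_eq)
  show "\<exists>s\<in>carrier box_group. s \<otimes>\<^bsub>box_group\<^esub> r = \<one>\<^bsub>box_group\<^esub>"
    using r box_neg[of r]
    by (intro bexI[of _ "\<lambda>v. frac (- r v)"]) (auto simp: box_group_def)
qed (auto simp: box_group_def zero_in_box add.assoc)

lemma inv_box_group:
  assumes "r \<in> box"
  shows "inv\<^bsub>box_group\<^esub> r = (\<lambda>v. frac (- r v))"
proof -
  interpret group box_group by (rule group_box_group)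
  show ?thesis
    using assms box_neg[of r]
    by (intro inv_equality) (auto simp: box_group_def)
qed

text \<open>The box points vanishing at \<open>v\<close> form a subgroup, whose order divides a
  prime. It contains the nonzero \<open>r\<close>, so it is everything.\<close>

lemma prime_box_coordinate:
  assumes "prime (card box)" "r \<in> box" "r \<noteq> (\<lambda>_. 0)" "r v = 0" "s \<in> box"
  shows "s v = 0"
proof -
  interpret group box_group by (rule group_box_group)
  let ?H = "{r \<in> box. r v = 0}"
  have "subgroup ?H box_group"
  proof (rule subgroupI)
    show "?H \<noteq> {}" using zero_in_box by auto
  next
    fix r assume "r \<in> ?H"
    then show "inv\<^bsub>box_group\<^esub> r \<in> ?H"
      using box_neg by (auto simp: inv_box_group)
  next
    fix r s assume "r \<in> ?H" "s \<in> ?H"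
    then show "r \<otimes>\<^bsub>box_group\<^esub> s \<in> ?H"
      using m_closed[of r s] by (auto simp: box_group_def)
  qed (auto simp: box_group_def)
  then have "card (rcosets\<^bsub>box_group\<^esub> ?H) * card ?H = card box"
    using lagrange by (simp add: order_def box_group_def)
  then have "card ?H dvd card box"
    by (intro dvdI[where k = "card (rcosets\<^bsub>box_group\<^esub> ?H)"]) (simp only: mult.commute)
  then have "card ?H = 1 \<or> card ?H = card box"
    using assms(1) by (simp add: prime_nat_iff)
  moreover have "card ?H \<noteq> 1"
  proof
    assume "card ?H = 1"
    then obtain x where x: "?H = {x}" by (rule card_1_singletonE)
    have "r \<in> ?H" "(\<lambda>_. 0) \<in> ?H" using assms zero_in_box by auto
    then have "r = x" "(\<lambda>_. 0) = x" unfolding x by (simp_all only: singleton_iff)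
    with assms(3) show False by simp
  qed
  ultimately have "card ?H = card box" by blast
  then have "?H = box"
    by (intro card_subset_eq finite_box) auto
  with assms(5) have "s \<in> ?H" by (simp only:)
  then show ?thesis by simp
qed

section \<open>Inversion in the box and symmetry of the delta-vector\<close>

definition active :: "(real ^ 'n) set"
  where "active = {v \<in> V. \<exists>r\<in>box. r v \<noteq> 0}"

text \<open>By \<open>prime_box_coordinate\<close> a nonzero box point is nonzero on all of
  \<open>active\<close>. Negation modulo 1 replaces each weight there by its complement to 1 and
  keeps the zeros elsewhere.\<close>

lemma degree_neg:
  assumes "prime (card box)" "r \<in> box" "r \<noteq> (\<lambda>_. 0)"
  shows "sum (\<lambda>v. frac (- r v)) V = real (card active) - sum r V"
proof -
  have "frac (- r v) = (if v \<in> active then 1 else 0) - r v" if "v \<in> V" for v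
  proof (cases "r v = 0")
    case True
    with prime_box_coordinate[OF assms(1-3), of v] have "v \<notin> active"
      by (auto simp: active_def)
    with True show ?thesis by simp
  next
    case False
    then have "v \<in> active" using assms that by (auto simp: active_def)
    moreover have "frac (r v) = r v"
      using assms by (simp add: box_def frac_eq)
    ultimately show ?thesis
      using False by (auto simp: frac_neg simp flip: frac_eq_0_iff)
  qed
  then have "sum (\<lambda>v. frac (- r v)) V = (\<Sum>v\<in>V. (if v \<in> active then 1 else 0) - r v)"
    by (intro sum.cong) auto
  also have "\<dots> = real (card (V \<inter> active)) - sum r V"
    using finite_V by (simp add: sum_subtractf sum.If_cases Int_def)
  also have "V \<inter> active = active" by (auto simp: active_def)
  finally show ?thesis .
qed

lemma box_neg_neg: "r \<in> box \<Longrightarrow> (\<lambda>v. frac (- frac (- r v))) = r"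
  by (simp add: box_def frac_neg_frac frac_eq)

lemma box_degree_0: "r \<in> box \<Longrightarrow> sum r V = 0 \<Longrightarrow> r = (\<lambda>_. 0)"
  using cut_weights_0 by (auto simp: box_def cut_weights_def)

text \<open>Negation is an involution of the box, hence injective. Positive degree makes
  \<open>r\<close> nonzero, and \<open>i < card active\<close> makes the natural subtraction exact.
  Used at \<open>i\<close> and at \<open>card active - i\<close>, this gives equality.\<close>

lemma card_cut_weights_neg_le:
  assumes "prime (card box)" "0 < i" "i < card active"
  shows "card (cut_weights V i) \<le> card (cut_weights V (card active - i))"
proof (rule card_inj_on_le)
  show "inj_on (\<lambda>r v. frac (- r v)) (cut_weights V i)"
    by (rule inj_on_inverseI[where g = "\<lambda>r v. frac (- r v)"]) (auto simp: cut_weights_V box_neg_neg)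
  show "(\<lambda>r v. frac (- r v)) ` cut_weights V i \<subseteq> cut_weights V (card active - i)"
  proof
    fix s assume "s \<in> (\<lambda>r v. frac (- r v)) ` cut_weights V i"
    then obtain r where r: "r \<in> box" "sum r V = real i" "s = (\<lambda>v. frac (- r v))"
      by (auto simp: cut_weights_V)
    moreover have "r \<noteq> (\<lambda>_. 0)" using r assms by auto
    ultimately show "s \<in> cut_weights V (card active - i)"
      using assms degree_neg[of r] box_neg[of r] by (simp add: cut_weights_V)
  qed
qed (rule finite_cut_weights)

lemma delta_symmetric:
  assumes "prime (card box)" "0 < i" "i < card active"
  shows "delta (convex hull V) i = delta (convex hull V) (card active - i)"
proof -
  have "0 < card active - i" "card active - i < card active" "card active - (card active - i) = i"
    using assms by auto
  with card_cut_weights_neg_le[OF assms] card_cut_weights_neg_le[OF assms(1), of "card active - i"]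
  show ?thesis by (simp add: delta_eq)
qed

text \<open>The inverse of a nonzero box point is nonzero too, so its degree
  \<open>card active - i\<close> is positive.\<close>

lemma delta_nonzero_less:
  assumes "prime (card box)" "0 < i" "delta (convex hull V) i \<noteq> 0"
  shows "i < card active"
proof -
  have "cut_weights V i \<noteq> {}"
    using assms by (auto simp: delta_eq)
  then obtain r where r: "r \<in> box" "sum r V = real i"
    by (auto simp: cut_weights_V)
  then have "r \<noteq> (\<lambda>_. 0)" using assms by auto
  let ?s = "\<lambda>v. frac (- r v)"
  have "?s \<noteq> (\<lambda>_. 0)"
  proof
    assume "?s = (\<lambda>_. 0)"
    then have "(\<lambda>v. frac (- ?s v)) = (\<lambda>_. 0)" by (simp add: fun_eq_iff)
    with box_neg_neg[OF r(1)] \<open>r \<noteq> (\<lambda>_. 0)\<close> show False by simp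
  qed
  then have "sum ?s V \<noteq> 0"
    using box_degree_0[OF box_neg[OF r(1)]] by blast
  moreover have "sum ?s V \<ge> 0" by (intro sum_nonneg) auto
  ultimately show ?thesis
    using degree_neg[OF assms(1) r(1) \<open>r \<noteq> (\<lambda>_. 0)\<close>] r by simp
qed

text \<open>A prime exceeds 1, so the box has a point besides the neutral one. This keeps the set
  under \<open>Min\<close> nonempty.\<close>

lemma ex_delta_nonzero:
  assumes "prime (card box)"
  shows "\<exists>i>0. i < card V \<and> delta (convex hull V) i \<noteq> 0"
proof -
  have "card box > 1" using assms by (rule prime_gt_1_nat)
  then have "\<not> box \<subseteq> {\<lambda>_. 0}"
    by (auto dest!: card_mono[rotated])
  then obtain r where r: "r \<in> box" "r \<noteq> (\<lambda>_. 0)" by auto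
  obtain i where i: "i < card V" "sum r V = real i" using box_degree[OF r(1)] .
  have "i \<noteq> 0" using i r box_degree_0[OF r(1)] by auto
  moreover have "r \<in> cut_weights V i" using r i by (simp add: cut_weights_V)
  then have "delta (convex hull V) i \<noteq> 0"
    using finite_cut_weights by (auto simp: delta_eq)
  ultimately show ?thesis using i by auto
qed

end

theorem theorem2p2:
  fixes P :: "(real ^ 'n) set" and d p :: nat
  assumes "int d simplex P"
    and "integral_polytope P"
    and "prime p"
    and "normalized_volume P = int p"
    and "Min {i. 0 < i \<and> i \<le> d \<and> delta P i \<noteq> 0} = d + 1 - Max {i. i \<le> d \<and> delta P i \<noteq> 0}"
  shows "shifted_symmetric d (delta P)"
proof -
  obtain V where V: "\<not> affine_dependent V" "int (card V) = int d + 1" "P = convex hull V"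
    using assms(1) by (auto simp: simplex)
  then have card_V: "card V = d + 1" by linarith
  interpret lattice_simplex V
  proof
    show "V \<subseteq> integer_lattice"
      using assms(2) V extreme_point_of_convex_hull_affine_independent[OF V(1)]
      by (auto simp: integral_polytope_def)
  qed (use V card_V in auto)
  have prime: "prime (card box)"
    using assms(3,4) V(3) normalized_volume_eq by simp
  let ?A = "{i. 0 < i \<and> i \<le> d \<and> delta P i \<noteq> 0}"
  let ?M = "{i. i \<le> d \<and> delta P i \<noteq> 0}"
  have less: "i < card active" if "i \<in> ?A" for i
    using that delta_nonzero_less[OF prime] V(3) by auto
  have "card active \<le> d + 1"
    using card_mono[OF finite_V, of active] card_V by (auto simp: active_def)
  \<comment> \<open>Since \<open>i > 0\<close> and \<open>card active \<le> d + 1\<close>, the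
    reflected index stays at most \<open>d\<close>.\<close>
  then have refl: "card active - i \<in> ?A" if "i \<in> ?A" for i
    using that less[OF that] delta_symmetric[OF prime, of i] V(3) by auto
  have fin: "finite ?A" "finite ?M" by auto
  have "?A \<noteq> {}"
    using ex_delta_nonzero[OF prime] card_V V(3) by (auto simp: less_Suc_eq_le)
  then obtain j where j: "j \<in> ?A" by blast
  have min: "Min ?A \<in> ?A" using \<open>?A \<noteq> {}\<close> fin by (rule_tac Min_in)
  \<comment> \<open>\<open>?M\<close> may contain the index 0, but its maximum is at least
    \<open>j > 0\<close> and so belongs to \<open>?A\<close>.\<close>
  have "j \<le> Max ?M" using j fin by (intro Max_ge) auto
  moreover have "Max ?M \<in> ?M" using j fin by (intro Max_in) auto
  ultimately have max: "Max ?M \<in> ?A" using j by auto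
  \<comment> \<open>Reflecting both extremes gives minimum plus maximum equal to
    \<open>card active\<close>; the hypothesis makes this sum \<open>d + 1\<close>.\<close>
  have "Min ?A \<le> card active - Max ?M"
    using refl[OF max] fin by (intro Min_le)
  moreover have "card active - Min ?A \<le> Max ?M"
    using refl[OF min] fin by (intro Max_ge) auto
  ultimately have "card active = d + 1"
    using assms(5) less[OF max] less[OF min] max by auto
  \<comment> \<open>Reflection in \<open>d + 1\<close> sends \<open>i + 1\<close> to
    \<open>d - i\<close>.\<close>
  then have "delta P (d - i) = delta P (i + 1)" if "i < d" for i
    using delta_symmetric[OF prime, of "i + 1"] that V(3) by simp
  \<comment> \<open>For \<open>d = 0\<close> the bound is -1, so no index qualifies.\<close>
  moreover have "i < d" if "int i \<le> (int d - 1) div 2" for i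
    using that by linarith
  ultimately show ?thesis
    unfolding shifted_symmetric_def by blast
qed

end
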